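(* Assume that the MPSC piecewise weak constant rank condition (MPSC-PWCR) holds at $\bar{x}\in\mathcal{F}$. Then the MPSC-tailored weak second-order constraint qualification (MPSC-WSOCQ) holds at $\bar{x}$.
   Context: (MPSC) is the problem: minimize $f(x)$ over $x\in\mathbb{R}^n$ subject to $g_i(x)\le 0$ ($i=1,\dots,m$), $h_j(x)=0$ ($j=1,\dots,p$), $G_k(x)H_k(x)=0$ ($k=1,\dots,l$), where $f,g_i,h_j,G_k,H_k:\mathbb{R}^n\to\mathbb{R}$ are twice continuously differentiable. $\mathcal{F}$ denotes its feasible set. For a feasible point $\bar{x}$: $\mathcal{I}_h=\{1,\dots,p\}$, $\mathcal{I}_g=\{i: g_i(\bar{x})=0\}$, $\mathcal{I}_G=\{k: G_k(\bar{x})=0,\,H_k(\bar{x})\neq0\}$, $\mathcal{I}_H=\{k: G_k(\bar{x})\ne0,\,H_k(\bar{x})=0\}$, $\mathcal{I}_{GH}=\{k: G_k(\bar{x})=H_k(\bar{x})=0\}$. $\mathcal{P}(\mathcal{I}_{GH})$ is the set of all pairs $(\beta_1,\beta_2)$ of disjoint (possibly empty) sets with $\beta_1\cup\beta_2=\mathcal{I}_{GH}$. MPSC-PWCR holds at $\bar{x}$ if for each $(\beta_1,\beta_2)\in\mathcal{P}(\mathcal{I}_{GH})$ there is $\varepsilon>0$ such that the rank of the family $\{\nabla g_i(x)\}_{i\in\mathcal{I}_g}\cup\{\nabla h_j(x)\}_{j\in\mathcal{I}_h}\cup\{\nabla G_k(x)\}_{k\in\mathcal{I}_G\cup\beta_1}\cup\{\nabla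 H_k(x)\}_{k\in\mathcal{I}_H\cup\beta_2}$ is constant for all $x$ with $\|x-\bar{x}\|<\varepsilon$. Critical subspace: $\tilde{\mathcal{C}}^{MPSC}_{\mathcal{F}}(\bar{x})$ is the set of $d\in\mathbb{R}^n$ with $\nabla g_i(\bar{x})^\top d=0$ ($i\in\mathcal{I}_g$), $\nabla h_j(\bar{x})^\top d=0$ ($j\in\mathcal{I}_h$), $\nabla G_k(\bar{x})^\top d=0$ ($k\in\mathcal{I}_G\cup\mathcal{I}_{GH}$), $\nabla H_k(\bar{x})^\top d=0$ ($k\in\mathcal{I}_H\cup\mathcal{I}_{GH}$). MPSC-WSOCQ holds at $\bar{x}$ if for every nonzero $\tilde d\in\tilde{\mathcal{C}}^{MPSC}_{\mathcal{F}}(\bar{x})$ there exist $\delta>0$, sets $\mathcal{J},\mathcal{K}\subseteq\mathcal{I}_{GH}$ and a twice differentiable arc $\zeta:[0,\delta)\to\mathbb{R}^n$ such that $\zeta(t)\in\mathcal{F}$ for all $t\in[0,\delta)$; $\zeta(0)=\bar{x}$ and $\zeta'_+(0)=\tilde d$ (right derivative); and for all $t\in[0,\delta)$: $g_i(\zeta(t))=0$ for $i\in\mathcal{I}_g$, $G_k(\zeta(t))=0$ for $k\in\mathcal{I}_G\cup\mathcal{J}$, $H_k(\zeta(t))=0$ for $k\in\mathcal{I}_H\cup\mathcal{K}$. *)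

theory Defs
  imports "HOL-Analysis.Analysis"
begin

section \<open>Differentiability\<close>

definition gradient :: "(real^'n \<Rightarrow> real) \<Rightarrow> real^'n \<Rightarrow> real^'n" where
  "gradient f x = (THE D. GDERIV f x :> D)"

lemma gradient_eqI:
  assumes "GDERIV f x :> D"
  shows "gradient f x = D"
  unfolding gradient_def
proof (rule the_equality)
  show "GDERIV f x :> D" by (rule assms)
next
  fix E assume "GDERIV f x :> E"
  then have eq: "(\<lambda>v. v \<bullet> E) = (\<lambda>v. v \<bullet> D)"
    using assms unfolding gderiv_def by (rule has_derivative_unique)
  have "\<forall>v. v \<bullet> E = v \<bullet> D"
    using fun_cong[OF eq] by (rule allI)
  then show "E = D"
    by (rule vector_eq_ldot[THEN iffD1])
qed

lemma GDERIV_gradient: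
  assumes "f differentiable (at x)"
  shows "GDERIV f x :> gradient f x"
proof -
  obtain f' where f': "(f has_derivative f') (at x)"
    using assms unfolding differentiable_def by blast
  then have lin: "linear f'" by (rule has_derivative_linear)
  have "f' v = v \<bullet> adjoint f' 1" for v
    using adjoint_works[OF lin, of v 1] by simp
  then have eq: "f' = (\<lambda>v. v \<bullet> adjoint f' 1)" by (rule ext)
  have G: "GDERIV f x :> adjoint f' 1"
    unfolding gderiv_def by (rule subst[OF eq, of "\<lambda>h. (f has_derivative h) (at x)", OF f'])
  show ?thesis
    unfolding gradient_eqI[OF G] by (rule G)
qed

definition twice_continuously_differentiable :: "(real^'n \<Rightarrow> real) \<Rightarrow> bool" where
  "twice_continuously_differentiable f \<longleftrightarrow>
     (\<forall>x. f differentiable (at x)) \<and>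
     (\<exists>Hess :: real^'n \<Rightarrow> real^'n^'n.
        (\<forall>x. (gradient f has_derivative (\<lambda>v. Hess x *v v)) (at x)) \<and>
        continuous_on UNIV Hess)"

text \<open>
  Derivatives are taken within the domain \<open>S\<close>; at the left endpoint of
  \<open>S = {0..<\<delta>}\<close> they are therefore one-sided.
\<close>

definition twice_differentiable_arc_on :: "(real \<Rightarrow> real^'n) \<Rightarrow> real set \<Rightarrow> bool" where
  "twice_differentiable_arc_on \<zeta> S \<longleftrightarrow>
     (\<exists>\<zeta>'. (\<forall>t\<in>S. (\<zeta> has_vector_derivative \<zeta>' t) (at t within S)) \<and> \<zeta>' differentiable_on S)"

section \<open>Mathematical programs with switching constraints\<close>

text \<open>
  The constraints are indexed by the natural numbers \<open>1..m\<close>, \<open>1..p\<close> and \<open>1..l\<close>, so that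
  each kind of constraint may be absent; component functions with indices outside these
  ranges are irrelevant.
\<close>

record ('n::finite) mpsc =
  num_ineq :: nat
  num_eq :: nat
  num_switch :: nat
  objective :: "real^'n \<Rightarrow> real"
  con_g :: "nat \<Rightarrow> real^'n \<Rightarrow> real"
  con_h :: "nat \<Rightarrow> real^'n \<Rightarrow> real"
  con_G :: "nat \<Rightarrow> real^'n \<Rightarrow> real"
  con_H :: "nat \<Rightarrow> real^'n \<Rightarrow> real"

definition C2_data :: "('n::finite) mpsc \<Rightarrow> bool" where
  "C2_data P \<longleftrightarrow>
     twice_continuously_differentiable (objective P) \<and>
     (\<forall>i\<in>{1..num_ineq P}. twice_continuously_differentiable (con_g P i)) \<and>
     (\<forall>j\<in>{1..num_eq P}. twice_continuously_differentiable (con_h P j)) \<and>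
     (\<forall>k\<in>{1..num_switch P}. twice_continuously_differentiable (con_G P k) \<and>
                               twice_continuously_differentiable (con_H P k))"

definition feasible_set :: "('n::finite) mpsc \<Rightarrow> (real^'n) set" where
  "feasible_set P = {x.
     (\<forall>i\<in>{1..num_ineq P}. con_g P i x \<le> 0) \<and>
     (\<forall>j\<in>{1..num_eq P}. con_h P j x = 0) \<and>
     (\<forall>k\<in>{1..num_switch P}. con_G P k x * con_H P k x = 0)}"

definition I_h :: "('n::finite) mpsc \<Rightarrow> nat set" where
  "I_h P = {1..num_eq P}"

definition I_g :: "('n::finite) mpsc \<Rightarrow> real^'n \<Rightarrow> nat set" where
  "I_g P x = {i\<in>{1..num_ineq P}. con_g P i x = 0}"

definition I_G :: "('n::finite) mpsc \<Rightarrow> real^'n \<Rightarrow> nat set" where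
  "I_G P x = {k\<in>{1..num_switch P}. con_G P k x = 0 \<and> con_H P k x \<noteq> 0}"

definition I_H :: "('n::finite) mpsc \<Rightarrow> real^'n \<Rightarrow> nat set" where
  "I_H P x = {k\<in>{1..num_switch P}. con_G P k x \<noteq> 0 \<and> con_H P k x = 0}"

definition I_GH :: "('n::finite) mpsc \<Rightarrow> real^'n \<Rightarrow> nat set" where
  "I_GH P x = {k\<in>{1..num_switch P}. con_G P k x = 0 \<and> con_H P k x = 0}"

definition bipartitions :: "'a set \<Rightarrow> ('a set \<times> 'a set) set" where
  "bipartitions I = {(\<beta>\<^sub>1, \<beta>\<^sub>2). \<beta>\<^sub>1 \<inter> \<beta>\<^sub>2 = {} \<and> \<beta>\<^sub>1 \<union> \<beta>\<^sub>2 = I}"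

text \<open>
  The index sets are taken at the reference point \<open>xbar\<close>, the gradients at \<open>x\<close>.
\<close>

definition gradient_family ::
    "('n::finite) mpsc \<Rightarrow> real^'n \<Rightarrow> nat set \<Rightarrow> nat set \<Rightarrow> real^'n \<Rightarrow> (real^'n) set" where
  "gradient_family P xbar \<beta>\<^sub>1 \<beta>\<^sub>2 x =
     (\<lambda>i. gradient (con_g P i) x) ` I_g P xbar \<union>
     (\<lambda>j. gradient (con_h P j) x) ` I_h P \<union>
     (\<lambda>k. gradient (con_G P k) x) ` (I_G P xbar \<union> \<beta>\<^sub>1) \<union>
     (\<lambda>k. gradient (con_H P k) x) ` (I_H P xbar \<union> \<beta>\<^sub>2)"

definition MPSC_PWCR :: "('n::finite) mpsc \<Rightarrow> real^'n \<Rightarrow> bool" where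
  "MPSC_PWCR P xbar \<longleftrightarrow>
     (\<forall>(\<beta>\<^sub>1, \<beta>\<^sub>2) \<in> bipartitions (I_GH P xbar). \<exists>\<epsilon>>0.
        (\<lambda>x. dim (gradient_family P xbar \<beta>\<^sub>1 \<beta>\<^sub>2 x)) constant_on {x. norm (x - xbar) < \<epsilon>})"

definition critical_subspace :: "('n::finite) mpsc \<Rightarrow> real^'n \<Rightarrow> (real^'n) set" where
  "critical_subspace P xbar = {d.
     (\<forall>i\<in>I_g P xbar. gradient (con_g P i) xbar \<bullet> d = 0) \<and>
     (\<forall>j\<in>I_h P. gradient (con_h P j) xbar \<bullet> d = 0) \<and>
     (\<forall>k\<in>I_G P xbar \<union> I_GH P xbar. gradient (con_G P k) xbar \<bullet> d = 0) \<and>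
     (\<forall>k\<in>I_H P xbar \<union> I_GH P xbar. gradient (con_H P k) xbar \<bullet> d = 0)}"

definition MPSC_WSOCQ :: "('n::finite) mpsc \<Rightarrow> real^'n \<Rightarrow> bool" where
  "MPSC_WSOCQ P xbar \<longleftrightarrow>
     (\<forall>d\<in>critical_subspace P xbar. d \<noteq> 0 \<longrightarrow>
        (\<exists>\<delta>>0. \<exists>J K. \<exists>\<zeta> :: real \<Rightarrow> real^'n.
           J \<subseteq> I_GH P xbar \<and> K \<subseteq> I_GH P xbar \<and>
           twice_differentiable_arc_on \<zeta> {0..<\<delta>} \<and>
           (\<forall>t\<in>{0..<\<delta>}. \<zeta> t \<in> feasible_set P) \<and>
           \<zeta> 0 = xbar \<and> (\<zeta> has_vector_derivative d) (at_right 0) \<and>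
           (\<forall>t\<in>{0..<\<delta>}.
              (\<forall>i\<in>I_g P xbar. con_g P i (\<zeta> t) = 0) \<and>
              (\<forall>k\<in>I_G P xbar \<union> J. con_G P k (\<zeta> t) = 0) \<and>
              (\<forall>k\<in>I_H P xbar \<union> K. con_H P k (\<zeta> t) = 0))))"

end

theory Submission
  imports Defs
begin

text \<open>
  Take the bipartition \<open>(I_GH, {})\<close>: the arc is made to satisfy \<open>G\<^sub>k = 0\<close> for every
  biactive index \<open>k\<close>, so that the product \<open>G\<^sub>k H\<^sub>k\<close> vanishes along it whatever \<open>H\<^sub>k\<close> does. What
  remains is a statement about the finite set \<open>\<F>\<close> of the functions that are to stay zero: if
  all \<open>f \<in> \<F>\<close> vanish at \<open>xbar\<close>, the rank of their gradients is constant near \<open>xbar\<close>, and \<open>d\<close> is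
  orthogonal to all gradients at \<open>xbar\<close>, then some twice differentiable arc through
  \<open>xbar\<close> with velocity \<open>d\<close> stays in the common zero set of \<open>\<F>\<close>
  (lemma \<open>arc_in_constant_rank_level_set\<close>). The inactive inequalities are strict at \<open>xbar\<close> and
  therefore survive on a neighbourhood.

  The arc comes from a change of coordinates. Choose functions of \<open>\<F>\<close> whose gradients at \<open>xbar\<close>
  form a basis of the span of all gradients there, and add linear functions to obtain \<open>n\<close> functions
  with linearly independent gradients. By the inverse function theorem they are local coordinates
  \<open>\<Phi>\<close>, and the arc is the preimage under \<open>\<Phi>\<close> of the line through \<open>\<Phi>(xbar)\<close> with direction
  \<open>\<Phi>'(xbar) d\<close> (lemma \<open>coordinate_line\<close>). The chosen functions of \<open>\<F>\<close> are coordinates in which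
  the direction has component zero, so their gradients are orthogonal to the velocity. By the rank
  condition these gradients still span all gradients of \<open>\<F>\<close> at each point of the arc; hence the
  velocity of the arc is orthogonal to every gradient of \<open>\<F>\<close>, and every function of \<open>\<F>\<close> is
  constant along the arc.
\<close>

section \<open>Matrices: differentiability of determinants, and independent rows\<close>

lemma differentiable_vec_lambda:
  fixes f :: "_ \<Rightarrow> 'n::finite \<Rightarrow> real"
  assumes "\<And>k. (\<lambda>x. f x k) differentiable F"
  shows "(\<lambda>x. \<chi> k. f x k) differentiable F"
proof -
  have "(\<lambda>x. f x k *\<^sub>R axis k 1 :: real^'n) differentiable F" for k
    using assms[of k] has_derivative_scaleR_left unfolding differentiable_def by blast
  then have "(\<lambda>x. \<Sum>k\<in>UNIV. f x k *\<^sub>R axis k 1 :: real^'n) differentiable F"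
    by (intro differentiable_sum) auto
  moreover have "(\<Sum>k\<in>UNIV. f x k *\<^sub>R axis k 1) = (\<chi> k. f x k)" for x
    by (simp add: vec_eq_iff axis_def if_distrib cong: if_cong)
  ultimately show ?thesis by simp
qed

lemma differentiable_vec_nth:
  fixes f :: "_ \<Rightarrow> 'b::real_normed_vector ^ 'n"
  assumes "f differentiable F"
  shows "(\<lambda>x. f x $ k) differentiable F"
  using assms bounded_linear.has_derivative[OF bounded_linear_vec_nth]
  unfolding differentiable_def by blast

lemma differentiable_det:
  fixes A :: "_ \<Rightarrow> real^'n^'n"
  assumes "\<And>i j. (\<lambda>x. A x $ i $ j) differentiable (at t within S)"
  shows "(\<lambda>x. det (A x)) differentiable (at t within S)"
proof -
  have "(\<lambda>x. \<Prod>i\<in>UNIV. A x $ i $ p i) differentiable (at t within S)" for p :: "'n \<Rightarrow> 'n"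
  proof -
    have "\<forall>i. \<exists>D. ((\<lambda>x. A x $ i $ p i) has_derivative D) (at t within S)"
      using assms by (simp add: differentiable_def)
    then obtain D where "\<And>i. ((\<lambda>x. A x $ i $ p i) has_derivative D i) (at t within S)"
      by metis
    then have "((\<lambda>x. \<Prod>i\<in>UNIV. A x $ i $ p i) has_derivative
        (\<lambda>y. \<Sum>i\<in>UNIV. D i y * (\<Prod>j\<in>UNIV - {i}. A t $ j $ p j))) (at t within S)"
      by (rule has_derivative_prod)
    then show ?thesis
      unfolding differentiable_def by blast
  qed
  then show ?thesis
    unfolding det_def by (intro differentiable_sum ballI differentiable_mult differentiable_const) auto
qed

lemma det_nonzero_iff_inj:
  fixes A :: "real^'n^'n"
  shows "det A \<noteq> 0 \<longleftrightarrow> inj ((*v) A)"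
  by (simp add: invertible_det_nz[symmetric] invertible_left_inverse matrix_left_invertible_injective)

lemma det_nonzero_if_rows_span:
  fixes A :: "real^'n^'n"
  assumes "span (range (($) A)) = UNIV"
  shows "det A \<noteq> 0"
proof -
  have "x = 0" if x: "A *v x = 0" for x
  proof -
    have "r \<bullet> x = 0" if "r \<in> range (($) A)" for r
      using that x by (auto simp flip: matrix_vector_mul_component)
    then have "range (($) A) \<subseteq> {r. r \<bullet> x = 0}" by blast
    then have "span (range (($) A)) \<subseteq> {r. r \<bullet> x = 0}"
      by (rule span_minimal) (auto simp: subspace_def inner_left_distrib)
    then have "x \<bullet> x = 0" using assms by blast
    then show "x = 0" by simp
  qed
  then show ?thesis
    by (auto simp: det_nonzero_iff_inj vec.inj_iff_eq_0)
qed

text \<open>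
  The rows of an invertible matrix have a dual family, the columns of the inverse; a row cannot lie
  in the span of the others because that span is orthogonal to its dual vector.
\<close>

lemma rows_independent_if_det_nonzero:
  fixes A :: "real^'n^'n"
  assumes "det A \<noteq> 0"
  shows "inj (($) A)" and "independent (range (($) A))"
proof -
  have "invertible A"
    using assms by (simp add: invertible_det_nz)
  then have "surj ((*v) A)"
    using invertible_right_inverse matrix_right_invertible_surjective by blast
  then have "\<forall>i. \<exists>x. A *v x = axis i 1" by (metis surjD)
  then obtain u where u: "\<And>i. A *v u i = axis i 1" by metis
  have dual: "A $ j \<bullet> u i = (if j = i then 1 else 0)" for i j
    by (simp add: u axis_def flip: matrix_vector_mul_component)
  show inj: "inj (($) A)"
    by (rule injI) (metis dual zero_neq_one)
  show "independent (range (($) A))"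
  proof
    assume "dependent (range (($) A))"
    then obtain i where i: "A $ i \<in> span (range (($) A) - {A $ i})"
      unfolding dependent_def by blast
    have "range (($) A) - {A $ i} \<subseteq> {r. r \<bullet> u i = 0}"
      using dual by auto
    then have "span (range (($) A) - {A $ i}) \<subseteq> {r. r \<bullet> u i = 0}"
      by (rule span_minimal) (auto simp: subspace_def inner_left_distrib)
    with i have "A $ i \<bullet> u i = 0" by blast
    then show False by (simp add: dual)
  qed
qed

section \<open>Coordinate lines of a local diffeomorphism\<close>

text \<open>
  If \<open>n\<close> functions \<open>F i\<close> have independent gradients \<open>D i\<close> at \<open>xbar\<close>, they are local
  coordinates there, and \<open>\<zeta>\<close> is the curve that is a straight line in these coordinates and
  has velocity \<open>d\<close> at \<open>xbar\<close>; the last conclusion says that each coordinate changes at a constant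
  rate along it. The inverse function theorem gives only one derivative of
  \<open>\<zeta>\<close>. The second one comes from differentiating the solution \<open>\<zeta>' t\<close> of the linear system
  \<open>D i (\<zeta> t) \<bullet> \<zeta>' t = D i xbar \<bullet> d\<close>, whose coefficients are differentiable in \<open>t\<close>.
\<close>

lemma coordinate_line:
  fixes F :: "'n::finite \<Rightarrow> real^'n \<Rightarrow> real" and D :: "'n \<Rightarrow> real^'n \<Rightarrow> real^'n"
  assumes F: "\<And>i x. GDERIV (F i) x :> D i x"
    and D: "\<And>i x. D i differentiable (at x)"
    and det0: "det (\<chi> i. D i xbar) \<noteq> 0"
    and U: "open U" "xbar \<in> U"
  obtains \<delta> \<zeta> \<zeta>' where "\<delta> > 0" "\<zeta> 0 = xbar" "\<zeta>' 0 = d"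
    "\<And>t. \<bar>t\<bar> < \<delta> \<Longrightarrow> \<zeta> t \<in> U"
    "\<And>t. \<bar>t\<bar> < \<delta> \<Longrightarrow> (\<zeta> has_vector_derivative \<zeta>' t) (at t)"
    "\<And>t. \<bar>t\<bar> < \<delta> \<Longrightarrow> \<zeta>' differentiable (at t)"
    "\<And>t. \<bar>t\<bar> < \<delta> \<Longrightarrow> det (\<chi> i. D i (\<zeta> t)) \<noteq> 0"
    "\<And>t i. \<bar>t\<bar> < \<delta> \<Longrightarrow> D i (\<zeta> t) \<bullet> \<zeta>' t = D i xbar \<bullet> d"
proof -
  define \<Phi> where "\<Phi> = (\<lambda>x. \<chi> i. F i x)"
  define J :: "real^'n \<Rightarrow> real^'n^'n" where "J = (\<lambda>x. \<chi> i. D i x)"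
  have Jv: "J x *v v = (\<chi> i. D i x \<bullet> v)" for x v
    by (simp add: J_def vec_eq_iff matrix_vector_mul_component)
  define f' where "f' = (\<lambda>x. Blinfun ((*v) (J x)))"
  have f'[simp]: "blinfun_apply (f' x) = (*v) (J x)" for x
    unfolding f'_def by (rule bounded_linear_Blinfun_apply) (rule matrix_vector_mul_bounded_linear)
  have der: "(\<Phi> has_derivative blinfun_apply (f' x)) (at x)" for x
  proof (subst has_derivative_componentwise_within, intro ballI)
    fix b :: "real^'n" assume "b \<in> Basis"
    then obtain i where b: "b = axis i 1" by (auto simp: Basis_vec_def)
    show "((\<lambda>x. \<Phi> x \<bullet> b) has_derivative (\<lambda>v. blinfun_apply (f' x) v \<bullet> b)) (at x)"
      using F[of i x] by (simp add: b inner_axis Jv \<Phi>_def gderiv_def inner_commute[of "D i x"])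
  qed
  have Dcont: "continuous_on UNIV (D i)" for i
    using D[of i] by (simp add: continuous_on_eq_continuous_at differentiable_imp_continuous_within)
  have cont: "continuous_on U f'"
  proof (rule continuous_on_blinfun_componentwise)
    fix v :: "real^'n"
    show "continuous_on U (\<lambda>x. blinfun_apply (f' x) v)"
      unfolding f' Jv
      by (intro continuous_intros continuous_on_subset[OF Dcont]) auto
  qed
  have "invertible (J xbar)"
    using det0 by (simp add: invertible_det_nz J_def)
  then obtain B where B: "B ** J xbar = mat 1"
    unfolding invertible_def by blast
  define invf where "invf = Blinfun ((*v) B)"
  have "blinfun_apply invf = (*v) B"
    unfolding invf_def by (rule bounded_linear_Blinfun_apply) (rule matrix_vector_mul_bounded_linear)
  then have "invf o\<^sub>L f' xbar = id_blinfun"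
    by (intro blinfun_eqI) (simp add: matrix_vector_mul_assoc B)
  from inverse_function_theorem[OF U(1) der cont U(2) this]
  obtain U' V g g' where g: "open U'" "U' \<subseteq> U" "xbar \<in> U'" "open V" "\<Phi> xbar \<in> V"
    "homeomorphism U' V \<Phi> g"
    "\<And>y. y \<in> V \<Longrightarrow> (g has_derivative (g' y)) (at y)"
    "\<And>y. y \<in> V \<Longrightarrow> g' y = inv (blinfun_apply (f'(g y)))"
    "\<And>y. y \<in> V \<Longrightarrow> bij (blinfun_apply (f'(g y)))" by metis
  define w where "w = J xbar *v d"
  define y where "y = (\<lambda>t. \<Phi> xbar + t *\<^sub>R w)"
  define \<zeta> where "\<zeta> = (\<lambda>t. g (y t))"
  \<comment> \<open>Cramer's rule for the solution of \<open>J (\<zeta> t) *v x = w\<close>: unlike the inverse of the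
    derivative, it is visibly differentiable in \<open>t\<close>.\<close>
  define \<zeta>' where "\<zeta>' = (\<lambda>t. \<chi> k. det (\<chi> i j. if j = k then w $ i else J (\<zeta> t) $ i $ j) / det (J (\<zeta> t)))"
  have "open (y -` V)"
    unfolding y_def by (intro continuous_open_vimage g continuous_intros)
  moreover have "0 \<in> y -` V" using g by (simp add: y_def)
  ultimately obtain \<delta> where \<delta>: "\<delta> > 0" "ball 0 \<delta> \<subseteq> y -` V"
    using open_contains_ball by blast
  have yV: "y t \<in> V" if "\<bar>t\<bar> < \<delta>" for t
    using \<delta>(2) that by (auto simp: subset_iff)
  have detJ: "det (J (\<zeta> t)) \<noteq> 0" if "\<bar>t\<bar> < \<delta>" for t
    using g(9)[OF yV[OF that]] by (simp add: \<zeta>_def det_nonzero_iff_inj bij_is_inj)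
  have J\<zeta>': "J (\<zeta> t) *v \<zeta>' t = w" if "\<bar>t\<bar> < \<delta>" for t
    using cramer[OF detJ[OF that]] by (simp add: \<zeta>'_def)
  have \<zeta>'_eq: "\<zeta>' t = g' (y t) w" if t: "\<bar>t\<bar> < \<delta>" for t
    using J\<zeta>'[OF t] g(8)[OF yV[OF t]] g(9)[OF yV[OF t]]
    by (simp add: \<zeta>_def bij_is_inj inv_f_eq)
  have der\<zeta>: "(\<zeta> has_vector_derivative \<zeta>' t) (at t)" if t: "\<bar>t\<bar> < \<delta>" for t
  proof -
    have "(y has_vector_derivative w) (at t)"
      unfolding y_def by (auto intro!: derivative_eq_intros)
    then show ?thesis
      using vector_derivative_diff_chain_within[of y w t UNIV g "g' (y t)"] g(7)[OF yV[OF t]]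
      by (simp add: \<zeta>'_eq[OF t] \<zeta>_def o_def has_derivative_at_withinI)
  qed
  have diffJ: "(\<lambda>s. J (\<zeta> s) $ i $ j) differentiable (at t)" if t: "\<bar>t\<bar> < \<delta>" for t i j
  proof -
    have "\<zeta> differentiable (at t)"
      using der\<zeta>[OF t] differentiableI_vector by blast
    then have "(\<lambda>s. D i (\<zeta> s)) differentiable (at t)"
      by (intro differentiable_compose[OF D])
    then show ?thesis
      by (simp add: J_def differentiable_vec_nth)
  qed
  have diff\<zeta>': "\<zeta>' differentiable (at t)" if t: "\<bar>t\<bar> < \<delta>" for t
    unfolding \<zeta>'_def
  proof (rule differentiable_vec_lambda, rule differentiable_divide)
    fix k
    show "(\<lambda>s. det (\<chi> i j. if j = k then w $ i else J (\<zeta> s) $ i $ j)) differentiable (at t)"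
    proof (rule differentiable_det)
      fix i j
      show "(\<lambda>s. (\<chi> i j. if j = k then w $ i else J (\<zeta> s) $ i $ j) $ i $ j) differentiable (at t)"
        using diffJ[OF t, of i j] by (cases "j = k") simp_all
    qed
  qed (use diffJ[OF t] detJ[OF t] in \<open>auto intro: differentiable_det\<close>)
  show thesis
  proof (rule that[OF \<delta>(1)])
    show \<zeta>0: "\<zeta> 0 = xbar"
      using g(3,6) by (simp add: \<zeta>_def y_def homeomorphism_apply1)
    show "\<zeta>' 0 = d"
      using J\<zeta>'[of 0] \<delta>(1) det0
      by (simp add: \<zeta>0 w_def det_nonzero_iff_inj J_def inj_eq)
    fix t assume t: "\<bar>t\<bar> < \<delta>"
    show "\<zeta> t \<in> U"
      using g(2,6) yV[OF t] by (auto simp: \<zeta>_def homeomorphism_def)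
    show "(\<zeta> has_vector_derivative \<zeta>' t) (at t)" "\<zeta>' differentiable (at t)"
      by (rule der\<zeta>[OF t] diff\<zeta>'[OF t])+
    show "det (\<chi> i. D i (\<zeta> t)) \<noteq> 0"
      using detJ[OF t] by (simp add: J_def)
    fix i
    have "(J (\<zeta> t) *v \<zeta>' t) $ i = w $ i" by (simp add: J\<zeta>'[OF t])
    then show "D i (\<zeta> t) \<bullet> \<zeta>' t = D i xbar \<bullet> d"
      by (simp add: w_def Jv)
  qed
qed

section \<open>Arcs in level sets of constant rank\<close>

lemma C2_gderiv:
  assumes "twice_continuously_differentiable f"
  shows "GDERIV f x :> gradient f x"
  using assms by (simp add: twice_continuously_differentiable_def GDERIV_gradient)

lemma C2_gradient_differentiable:
  assumes "twice_continuously_differentiable f"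
  shows "gradient f differentiable (at x)"
  using assms unfolding twice_continuously_differentiable_def differentiable_def by blast

text \<open>
  The arc is a coordinate line for coordinates that contain a maximal independent part of \<open>\<F>\<close>. The
  gradients of the chosen functions are orthogonal to its velocity by construction. Those of the
  other functions are orthogonal too, because by the rank condition they lie in the span of the
  chosen gradients all along the arc.
\<close>

lemma arc_in_constant_rank_level_set:
  fixes \<F> :: "(real^'n \<Rightarrow> real) set" and xbar d :: "real^'n"
  assumes C2: "\<And>f. f \<in> \<F> \<Longrightarrow> twice_continuously_differentiable f"
    and S: "open S" "xbar \<in> S"
    and rank: "(\<lambda>x. dim ((\<lambda>f. gradient f x) ` \<F>)) constant_on S"
    and d: "\<And>f. f \<in> \<F> \<Longrightarrow> gradient f xbar \<bullet> d = 0"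
  obtains \<delta> \<zeta> where "\<delta> > 0" "\<zeta> 0 = xbar"
    "(\<zeta> has_vector_derivative d) (at 0)"
    "twice_differentiable_arc_on \<zeta> {0..<\<delta>}"
    "\<And>t. t \<in> {0..<\<delta>} \<Longrightarrow> \<zeta> t \<in> S"
    "\<And>t f. t \<in> {0..<\<delta>} \<Longrightarrow> f \<in> \<F> \<Longrightarrow> f (\<zeta> t) = f xbar"
proof -
  define \<G> where "\<G> = (\<lambda>x. (\<lambda>f. gradient f x) ` \<F>)"
  obtain W where W: "W \<subseteq> \<G> xbar" "independent W" "\<G> xbar \<subseteq> span W" "card W = dim (\<G> xbar)"
    by (rule basis_exists)
  obtain T where T: "W \<subseteq> T" "independent T" "UNIV \<subseteq> span T"
    using maximal_independent_subset_extend[OF subset_UNIV W(2)] by metis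
  have "card T = CARD('n)" "finite T"
    using basis_card_eq_dim[OF subset_UNIV T(3,2)] T(2) independent_imp_finite
    by auto
  then obtain \<tau> :: "'n \<Rightarrow> real^'n" where \<tau>: "bij_betw \<tau> UNIV T"
    using finite_same_card_bij[of "UNIV :: 'n set" T] by auto
  \<comment> \<open>The coordinates with index in \<open>I\<close> are functions from \<open>\<F>\<close>, the others are linear fillers.\<close>
  define I where "I = \<tau> -` W"
  have "\<forall>v\<in>W. \<exists>f\<in>\<F>. gradient f xbar = v"
    using W(1) by (auto simp: \<G>_def)
  then obtain \<phi> where \<phi>: "\<And>v. v \<in> W \<Longrightarrow> \<phi> v \<in> \<F> \<and> gradient (\<phi> v) xbar = v"
    by metis
  define F where "F = (\<lambda>i x. if i \<in> I then \<phi> (\<tau> i) x else x \<bullet> \<tau> i)"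
  define D where "D = (\<lambda>i x. if i \<in> I then gradient (\<phi> (\<tau> i)) x else \<tau> i)"
  have \<phi>I: "\<phi> (\<tau> i) \<in> \<F>" "gradient (\<phi> (\<tau> i)) xbar = \<tau> i" if "i \<in> I" for i
    using \<phi> that by (auto simp: I_def)
  have F: "GDERIV (F i) x :> D i x" for i x
  proof (cases "i \<in> I")
    case True
    then show ?thesis
      using C2_gderiv[OF C2[OF \<phi>I(1)[OF True]]] by (simp add: F_def D_def)
  next
    case False
    then show ?thesis
      by (simp add: F_def D_def gderiv_def) (auto intro!: derivative_eq_intros)
  qed
  have D: "D i differentiable (at x)" for i x
    using C2_gradient_differentiable[OF C2[OF \<phi>I(1)], of i]
    by (cases "i \<in> I") (simp_all add: D_def[abs_def])
  have Dxbar: "D i xbar = \<tau> i" for i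
    using \<phi>I by (simp add: D_def)
  have det0: "det (\<chi> i. D i xbar) \<noteq> 0"
  proof (rule det_nonzero_if_rows_span)
    have "range (($) (\<chi> i. D i xbar)) = T"
      using \<tau> by (auto simp: Dxbar bij_betw_def)
    then show "span (range (($) (\<chi> i. D i xbar))) = UNIV"
      using T(3) by auto
  qed
  obtain \<delta> \<zeta> \<zeta>' where \<zeta>: "\<delta> > 0" "\<zeta> 0 = xbar" "\<zeta>' 0 = d"
    "\<And>t. \<bar>t\<bar> < \<delta> \<Longrightarrow> \<zeta> t \<in> S"
    "\<And>t. \<bar>t\<bar> < \<delta> \<Longrightarrow> (\<zeta> has_vector_derivative \<zeta>' t) (at t)"
    "\<And>t. \<bar>t\<bar> < \<delta> \<Longrightarrow> \<zeta>' differentiable (at t)"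
    "\<And>t. \<bar>t\<bar> < \<delta> \<Longrightarrow> det (\<chi> i. D i (\<zeta> t)) \<noteq> 0"
    "\<And>t i. \<bar>t\<bar> < \<delta> \<Longrightarrow> D i (\<zeta> t) \<bullet> \<zeta>' t = D i xbar \<bullet> d"
    using coordinate_line[OF F D det0 S, of d] by metis
  have tangent: "gradient f (\<zeta> t) \<bullet> \<zeta>' t = 0" if t: "\<bar>t\<bar> < \<delta>" and f: "f \<in> \<F>" for t f
  proof -
    let ?x = "\<zeta> t"
    let ?R = "(\<lambda>i. D i ?x) ` I"
    have inj: "inj (\<lambda>i. D i ?x)" and ind: "independent (range (\<lambda>i. D i ?x))"
      using rows_independent_if_det_nonzero[OF \<zeta>(7)[OF t]] by (simp_all add: inj_def)
    have "card I = card W"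
      unfolding I_def using \<tau> T(1) by (intro card_vimage_inj) (auto simp: bij_betw_def)
    then have "card ?R = dim (\<G> xbar)"
      using W(4) card_image[OF inj_on_subset[OF inj subset_UNIV]] by metis
    also have "\<dots> = dim (\<G> ?x)"
      using rank S(2) \<zeta>(4)[OF t] unfolding constant_on_def \<G>_def by metis
    finally have "dim (span ?R) \<ge> dim (span (\<G> ?x))"
      using dim_eq_card_independent[OF independent_mono[OF ind image_mono[OF subset_UNIV]], of I]
      by simp
    moreover have "?R \<subseteq> \<G> ?x"
      using \<phi>I by (auto simp: D_def \<G>_def)
    ultimately have "span ?R = span (\<G> ?x)"
      by (intro subspace_dim_equal span_mono subspace_span)
    moreover have "gradient f ?x \<in> \<G> ?x"
      using f by (simp add: \<G>_def)
    ultimately have "gradient f ?x \<in> span ?R"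
      using span_base by blast
    moreover have "?R \<subseteq> {r. r \<bullet> \<zeta>' t = 0}"
    proof
      fix r assume "r \<in> ?R"
      then obtain i where i: "i \<in> I" "r = D i ?x" by blast
      then have "r \<bullet> \<zeta>' t = \<tau> i \<bullet> d"
        using \<zeta>(8)[OF t] by (simp add: Dxbar)
      also have "\<dots> = 0"
        using d \<phi>I[OF i(1)] by metis
      finally show "r \<in> {r. r \<bullet> \<zeta>' t = 0}" by simp
    qed
    then have "span ?R \<subseteq> {r. r \<bullet> \<zeta>' t = 0}"
      by (rule span_minimal) (auto simp: subspace_def inner_left_distrib)
    ultimately show ?thesis by blast
  qed
  have level: "f (\<zeta> t) = f xbar" if t: "\<bar>t\<bar> < \<delta>" and f: "f \<in> \<F>" for t f
  proof -
    have "((\<lambda>s. f (\<zeta> s)) has_derivative (\<lambda>h. 0)) (at s within {-\<delta><..<\<delta>})"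
      if "s \<in> {-\<delta><..<\<delta>}" for s
    proof -
      have s: "\<bar>s\<bar> < \<delta>" using that by auto
      have "((f \<circ> \<zeta>) has_derivative (\<lambda>v. v \<bullet> gradient f (\<zeta> s)) \<circ> (\<lambda>h. h *\<^sub>R \<zeta>' s)) (at s)"
        using \<zeta>(5)[OF s] C2_gderiv[OF C2[OF f]]
        by (intro diff_chain_at) (simp_all add: has_vector_derivative_def gderiv_def)
      then have "((\<lambda>s. f (\<zeta> s)) has_derivative (\<lambda>h. 0)) (at s)"
        using tangent[OF s f] by (simp add: o_def inner_commute)
      then show ?thesis by (rule has_derivative_at_withinI)
    qed
    from has_derivative_zero_unique[OF _ this, of "t" 0]
    show ?thesis using t \<zeta>(1,2) by (auto simp: abs_less_iff)
  qed
  show thesis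
  proof (rule that[of \<delta> \<zeta>, OF \<zeta>(1,2)])
    show "(\<zeta> has_vector_derivative d) (at 0)"
      using \<zeta>(5)[of 0] \<zeta>(1,3) by simp
    show "twice_differentiable_arc_on \<zeta> {0..<\<delta>}"
      unfolding twice_differentiable_arc_on_def differentiable_on_def
      using \<zeta>(5,6)
      by (intro exI[of _ \<zeta>'])
         (auto intro: has_vector_derivative_at_within differentiable_at_withinI)
  qed (use \<zeta>(4) level in auto)
qed

section \<open>The second-order constraint qualification\<close>

theorem lemma3p6:
  fixes P :: "('n::finite) mpsc" and xbar :: "real^'n"
  assumes "C2_data P"
    and "xbar \<in> feasible_set P"
    and "MPSC_PWCR P xbar"
  shows "MPSC_WSOCQ P xbar"
  unfolding MPSC_WSOCQ_def
proof (intro ballI impI)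
  fix d assume d: "d \<in> critical_subspace P xbar"
  define \<F> where "\<F> = con_g P ` I_g P xbar \<union> con_h P ` I_h P
    \<union> con_G P ` (I_G P xbar \<union> I_GH P xbar) \<union> con_H P ` I_H P xbar"
  have C2: "twice_continuously_differentiable f" if "f \<in> \<F>" for f
    using that assms(1)
    by (auto simp: \<F>_def C2_data_def I_g_def I_h_def I_G_def I_H_def I_GH_def)
  have zero: "f xbar = 0" if "f \<in> \<F>" for f
    using that assms(2)
    by (auto simp: \<F>_def feasible_set_def I_g_def I_h_def I_G_def I_H_def I_GH_def)
  have crit: "gradient f xbar \<bullet> d = 0" if "f \<in> \<F>" for f
    using that d by (auto simp: \<F>_def critical_subspace_def)
  have fam: "gradient_family P xbar (I_GH P xbar) {} x = (\<lambda>f. gradient f x) ` \<F>" for x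
    by (simp add: gradient_family_def \<F>_def image_Un image_image)
  \<comment> \<open>Assigning every biactive index to the \<open>G\<close>-side keeps its product zero without a condition on \<open>H\<close>.\<close>
  have "(I_GH P xbar, {}) \<in> bipartitions (I_GH P xbar)"
    by (simp add: bipartitions_def)
  then obtain \<epsilon> where \<epsilon>: "\<epsilon> > 0"
    "(\<lambda>x. dim ((\<lambda>f. gradient f x) ` \<F>)) constant_on {x. norm (x - xbar) < \<epsilon>}"
    using assms(3) unfolding MPSC_PWCR_def by (auto simp: fam)
  define N where "N = {i \<in> {1..num_ineq P}. con_g P i xbar < 0}"
  define S where "S = ball xbar \<epsilon> \<inter> (\<Inter>i\<in>N. {x. con_g P i x < 0})"
  have "open {x. con_g P i x < 0}" if "i \<in> N" for i
  proof -
    have "twice_continuously_differentiable (con_g P i)"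
      using that assms(1) by (auto simp: N_def C2_data_def)
    then have "continuous_on UNIV (con_g P i)"
      by (simp add: twice_continuously_differentiable_def continuous_on_eq_continuous_at
          differentiable_imp_continuous_within)
    then show ?thesis
      by (intro open_Collect_less) (auto intro: continuous_intros)
  qed
  then have S: "open S" "xbar \<in> S"
    using \<epsilon>(1) by (auto simp: S_def N_def intro!: open_INT)
  have "S \<subseteq> {x. norm (x - xbar) < \<epsilon>}"
    by (auto simp: S_def dist_norm norm_minus_commute)
  then have rank: "(\<lambda>x. dim ((\<lambda>f. gradient f x) ` \<F>)) constant_on S"
    using \<epsilon>(2) unfolding constant_on_def by blast
  obtain \<delta> \<zeta> where \<zeta>: "\<delta> > 0" "\<zeta> 0 = xbar"
    "(\<zeta> has_vector_derivative d) (at 0)"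
    "twice_differentiable_arc_on \<zeta> {0..<\<delta>}"
    "\<And>t. t \<in> {0..<\<delta>} \<Longrightarrow> \<zeta> t \<in> S"
    "\<And>t f. t \<in> {0..<\<delta>} \<Longrightarrow> f \<in> \<F> \<Longrightarrow> f (\<zeta> t) = f xbar"
    using arc_in_constant_rank_level_set[OF C2 S rank crit] by metis
  have act: "f (\<zeta> t) = 0" if "t \<in> {0..<\<delta>}" "f \<in> \<F>" for t f
    using \<zeta>(6)[OF that] zero[OF that(2)] by simp
  have feas: "\<zeta> t \<in> feasible_set P" if t: "t \<in> {0..<\<delta>}" for t
    unfolding feasible_set_def
  proof (intro CollectI conjI ballI)
    fix i assume i: "i \<in> {1..num_ineq P}"
    show "con_g P i (\<zeta> t) \<le> 0"
    proof (cases "con_g P i xbar = 0")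
      case True
      then show ?thesis using act[OF t, of "con_g P i"] i by (simp add: \<F>_def I_g_def)
    next
      case False
      then have "i \<in> N" using i assms(2) by (force simp: N_def feasible_set_def)
      then show ?thesis using \<zeta>(5)[OF t] by (auto simp: S_def)
    qed
  next
    fix j assume "j \<in> {1..num_eq P}"
    then show "con_h P j (\<zeta> t) = 0"
      using act[OF t, of "con_h P j"] by (simp add: \<F>_def I_h_def)
  next
    fix k assume "k \<in> {1..num_switch P}"
    then have "k \<in> I_G P xbar \<union> I_GH P xbar \<or> k \<in> I_H P xbar"
      using assms(2) by (auto simp: feasible_set_def I_G_def I_GH_def I_H_def)
    then have "con_G P k \<in> \<F> \<or> con_H P k \<in> \<F>"
      by (auto simp: \<F>_def)
    then show "con_G P k (\<zeta> t) * con_H P k (\<zeta> t) = 0"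
      using act[OF t] by auto
  qed
  show "\<exists>\<delta>>0. \<exists>J K. \<exists>\<zeta> :: real \<Rightarrow> real^'n.
           J \<subseteq> I_GH P xbar \<and> K \<subseteq> I_GH P xbar \<and>
           twice_differentiable_arc_on \<zeta> {0..<\<delta>} \<and>
           (\<forall>t\<in>{0..<\<delta>}. \<zeta> t \<in> feasible_set P) \<and>
           \<zeta> 0 = xbar \<and> (\<zeta> has_vector_derivative d) (at_right 0) \<and>
           (\<forall>t\<in>{0..<\<delta>}.
              (\<forall>i\<in>I_g P xbar. con_g P i (\<zeta> t) = 0) \<and>
              (\<forall>k\<in>I_G P xbar \<union> J. con_G P k (\<zeta> t) = 0) \<and>
              (\<forall>k\<in>I_H P xbar \<union> K. con_H P k (\<zeta> t) = 0))"
    using \<zeta>(1-4) feas act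
    by (intro exI[of _ \<delta>] conjI exI[of _ "I_GH P xbar"] exI[of _ "{}"] exI[of _ \<zeta>] ballI)
       (auto simp: \<F>_def intro: has_vector_derivative_at_within)
qed

end
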